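(* The equation $(45^{n}-1)(100^{n}-1)=x^{2}$ in positive integers $n,x$ has only the solution $n=1$, $x=66$. *)

theory Defs
  imports Main
begin

end

theory Submission
  imports Defs "HOL-Number_Theory.Euler_Criterion" "HOL-Number_Theory.Mod_Exp"
    "HOL-Number_Theory.Pocklington"
begin

text \<open>
  Even and odd exponents are excluded by two unrelated arguments.

  If \<open>n = 2 * m\<close>, then \<open>X = 45 ^ m\<close> and \<open>Y = 100 ^ m\<close> make \<open>(X\<^sup>2 - 1) * (Y\<^sup>2 - 1)\<close> a square, that is,
  \<open>X\<^sup>2 - 1 = D * u\<^sup>2\<close> and \<open>Y\<^sup>2 - 1 = D * v\<^sup>2\<close> with a common \<open>D\<close>: they are the first coordinates of
  \<open>\<gamma> ^ a\<close> and \<open>\<gamma> ^ b\<close> for the fundamental solution \<open>\<gamma>\<close> of a Pell equation. A common prime divisor of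
  \<open>X\<close> and \<open>Y\<close> forces \<open>a\<close> and \<open>b\<close> to contain the same power of 2, and then \<open>X\<close> and \<open>Y\<close> must have the
  same parity, which they do not. The lemma \<open>no_pell_pair\<close> runs this as a descent on the integers
  \<open>X\<close> and \<open>Y\<close> alone, so that neither \<open>D\<close> nor \<open>\<gamma>\<close> has to be mentioned.

  If \<open>n \<ge> 3\<close> is odd, then \<open>100 ^ n - 1\<close> is \<open>-1\<close> modulo 32, whereas it is 3 for the solution \<open>n = 1\<close>.
  So squares modulo 32 give a condition that \<open>n = 1\<close> need not satisfy: it turns out to be
  \<open>n mod 8 = 5\<close> (\<open>odd_exponent_mod_8\<close>). Once the exponents 0 and 1, for which the product really is a
  square, are out of the way, finitely many residue conditions modulo primes \<open>p\<close> with small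
  multiplicative orders of 45 and 100 suffice: 7, 17, 31, 641 and 2161, whose orders all divide 240,
  leave no residue class of \<open>n\<close> modulo 240 (\<open>exponent_5_mod_8\<close>).
\<close>

section \<open>Descent for even exponents\<close>

text \<open>
  With \<open>\<alpha> = X + u * sqrt D\<close>, \<open>\<beta> = Y + v * sqrt D\<close> and \<open>x = D * u * v\<close>, the numbers called \<open>X'\<close> and \<open>x'\<close>
  here belong to \<open>\<alpha> / \<beta>\<^sup>2\<close>: its first coordinate is \<open>X'\<close>, and \<open>x'\<close> is \<open>D * v\<close> times its second
  coordinate. Dividing by \<open>\<beta>\<^sup>2\<close> rather than by \<open>\<beta>\<close> keeps the class of \<open>X\<close> modulo 2 and modulo the
  divisors of \<open>Y\<close>.
\<close>

lemma pell_pair_step: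
  fixes X Y x :: int
  assumes sq: "(X\<^sup>2 - 1) * (Y\<^sup>2 - 1) = x\<^sup>2" and "x \<ge> 0" and "1 < Y" and "Y < X"
  defines "X' \<equiv> X * (2 * Y\<^sup>2 - 1) - 2 * Y * x"
    and "x' \<equiv> x * (2 * Y\<^sup>2 - 1) - 2 * X * Y * (Y\<^sup>2 - 1)"
  shows "(X'\<^sup>2 - 1) * (Y\<^sup>2 - 1) = x'\<^sup>2" and "\<bar>X'\<bar> < X"
proof -
  \<comment> \<open>The form \<open>(Y\<^sup>2 - 1) * X\<^sup>2 - x\<^sup>2\<close> is invariant because \<open>\<beta>\<close> has norm 1.\<close>
  have "(Y\<^sup>2 - 1) * X'\<^sup>2 - x'\<^sup>2 = (Y\<^sup>2 - 1) * X\<^sup>2 - x\<^sup>2"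
    unfolding X'_def x'_def by (simp add: algebra_simps power2_eq_square)
  with sq show "(X'\<^sup>2 - 1) * (Y\<^sup>2 - 1) = x'\<^sup>2"
    by (simp add: algebra_simps)
  have Y2: "Y\<^sup>2 > 1" and XY2: "Y\<^sup>2 < X\<^sup>2"
    using assms by (auto simp: power_strict_mono one_less_power)
  have "x\<^sup>2 = (X * Y)\<^sup>2 - X\<^sup>2 - Y\<^sup>2 + 1"
    using sq by (simp add: algebra_simps power_mult_distrib)
  then have "x\<^sup>2 < (X * Y)\<^sup>2"
    using Y2 XY2 by linarith
  then have "x < X * Y"
    using assms by (intro power2_less_imp_less[of x]) auto
  then have "Y * x < Y * (X * Y)"
    using assms by (intro mult_strict_left_mono) auto
  then have lower: "- X < X'"
    unfolding X'_def by (simp add: algebra_simps power2_eq_square)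
  have "(X * (Y\<^sup>2 - 1))\<^sup>2 = (Y\<^sup>2 - 1) * (X\<^sup>2 * (Y\<^sup>2 - 1))"
    by (simp add: power2_eq_square)
  also have "\<dots> < (Y\<^sup>2 - 1) * (Y\<^sup>2 * (X\<^sup>2 - 1))"
    using Y2 XY2 by (intro mult_strict_left_mono) (auto simp: algebra_simps)
  also have "\<dots> = Y\<^sup>2 * ((X\<^sup>2 - 1) * (Y\<^sup>2 - 1))"
    by simp
  also have "\<dots> = (Y * x)\<^sup>2"
    unfolding sq by (simp add: power_mult_distrib)
  finally have "X * (Y\<^sup>2 - 1) < Y * x"
    using assms by (intro power2_less_imp_less[of _ "Y * x"]) auto
  then have upper: "X' < X"
    unfolding X'_def by (simp add: algebra_simps)
  show "\<bar>X'\<bar> < X"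
    using lower upper by linarith
qed

text \<open>
  The step, applied to the larger of the two numbers, could be repeated for ever: parity keeps the
  two numbers different, and the common divisor \<open>p > 1\<close> keeps them away from 1, where the descent would
  stop at the trivial solution. Neither becomes 0: one is odd, and for \<open>Y = 0\<close> the product
  \<open>-(X\<^sup>2 - 1)\<close> is negative.
\<close>

lemma no_pell_pair:
  fixes X Y x p :: int
  assumes "p > 1" "p dvd X" "p dvd Y" "odd X" "even Y" "X > 0" "Y > 0"
  shows "(X\<^sup>2 - 1) * (Y\<^sup>2 - 1) \<noteq> x\<^sup>2"
  using assms
proof (induction "nat (X + Y)" arbitrary: X Y x rule: less_induct)
  case less
  note IH = less(1)
  have gt1: "X > 1" "Y > 1"
    using less.prems zdvd_imp_le[of p X] zdvd_imp_le[of p Y] by linarith+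
  show ?case
  proof
    assume "(X\<^sup>2 - 1) * (Y\<^sup>2 - 1) = x\<^sup>2"
    then have sq: "(X\<^sup>2 - 1) * (Y\<^sup>2 - 1) = \<bar>x\<bar>\<^sup>2"
      by simp
    have "X \<noteq> Y"
      using less.prems by auto
    then consider "Y < X" | "X < Y"
      by linarith
    then show False
    proof cases
      case 1
      define X' where "X' = X * (2 * Y\<^sup>2 - 1) - 2 * Y * \<bar>x\<bar>"
      obtain x' where x': "(X'\<^sup>2 - 1) * (Y\<^sup>2 - 1) = x'\<^sup>2" and "\<bar>X'\<bar> < X"
        using pell_pair_step[OF sq _ gt1(2) 1] unfolding X'_def by auto
      have "odd X'" "p dvd X'"
        unfolding X'_def using less.prems by auto
      then have "\<bar>X'\<bar> > 0"
        by auto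
      with IH[of "\<bar>X'\<bar>" Y x'] \<open>\<bar>X'\<bar> < X\<close> \<open>odd X'\<close> \<open>p dvd X'\<close> x' less.prems show False
        by auto
    next
      case 2
      define Y' where "Y' = Y * (2 * X\<^sup>2 - 1) - 2 * X * \<bar>x\<bar>"
      have "(Y\<^sup>2 - 1) * (X\<^sup>2 - 1) = \<bar>x\<bar>\<^sup>2"
        using sq by (simp add: mult.commute)
      from pell_pair_step[OF this _ gt1(1) 2]
      obtain y' where y': "(X\<^sup>2 - 1) * (Y'\<^sup>2 - 1) = y'\<^sup>2" and "\<bar>Y'\<bar> < Y"
        unfolding Y'_def by (auto simp: mult.commute)
      have "even Y'" "p dvd Y'"
        unfolding Y'_def using less.prems by auto
      have "X\<^sup>2 > 1"
        using gt1 by (simp add: one_less_power)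
      then have "Y' \<noteq> 0"
        using y' zero_le_power2[of y'] by (intro notI) simp
      with IH[of X "\<bar>Y'\<bar>" y'] \<open>\<bar>Y'\<bar> < Y\<close> \<open>even Y'\<close> \<open>p dvd Y'\<close> y' less.prems show False
        by auto
    qed
  qed
qed

section \<open>Residue conditions for odd exponents\<close>

lemma power_mod_exponent:
  fixes a m :: int
  assumes "a ^ M mod m = 1"
  shows "[a ^ n = a ^ (n mod M)] (mod m)"
proof -
  have "[a ^ M = 1] (mod m)"
    using assms mod_mod_trivial[of "a ^ M" m] by (simp add: cong_def)
  then have "[(a ^ M) ^ (n div M) * a ^ (n mod M) = 1 ^ (n div M) * a ^ (n mod M)] (mod m)"
    by (intro cong_mult cong_pow cong_refl)
  then show ?thesis
    by (simp flip: power_mult power_add)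
qed

text \<open>
  Euler's criterion in a form whose hypotheses, for numerals, are closed computations of
  modular powers.
\<close>

lemma not_square_mod_prime:
  fixes a b y :: int and p n M :: nat
  assumes p: "prime p" "p > 2"
    and period: "mod_exp a M (int p) = 1" "mod_exp b M (int p) = 1"
    and r: "n mod M = r"
    and nonresidue:
      "mod_exp ((mod_exp a r (int p) - 1) * (mod_exp b r (int p) - 1) mod int p)
         ((p - 1) div 2) (int p) = int p - 1"
  shows "(a ^ n - 1) * (b ^ n - 1) \<noteq> y\<^sup>2"
proof
  define c where "c = (a ^ n - 1) * (b ^ n - 1)"
  assume "(a ^ n - 1) * (b ^ n - 1) = y\<^sup>2"
  then have c: "c = y\<^sup>2"
    by (simp add: c_def)
  have "[a ^ n = a ^ r mod int p] (mod int p)" "[b ^ n = b ^ r mod int p] (mod int p)"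
    using power_mod_exponent[of a M "int p" n] power_mod_exponent[of b M "int p" n] period r
    by (auto simp: mod_exp_def cong_def)
  then have "[c = (a ^ r mod int p - 1) * (b ^ r mod int p - 1)] (mod int p)"
    unfolding c_def by (intro cong_mult cong_diff cong_refl)
  then have "[c ^ ((p - 1) div 2) =
      ((a ^ r mod int p - 1) * (b ^ r mod int p - 1) mod int p) ^ ((p - 1) div 2)] (mod int p)"
    by (intro cong_pow) simp
  then have "c ^ ((p - 1) div 2) mod int p = int p - 1"
    using nonresidue by (simp add: mod_exp_def cong_def)
  moreover have "[Legendre c (int p) = c ^ ((p - 1) div 2)] (mod int p)"
    using euler_criterion[OF p] .
  ultimately have "Legendre c (int p) mod int p = int p - 1"
    by (simp add: cong_def)
  moreover have "QuadRes (int p) c"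
    unfolding QuadRes_def c by (auto intro: cong_refl)
  ultimately show False
    using p by (auto simp: Legendre_def split: if_splits)
qed

text \<open>
  Since \<open>32 dvd 100 ^ n\<close>, the product is \<open>1 - 45 ^ n\<close> modulo 32, which for odd \<open>n\<close> is four times
  an odd number; it can only be a square if that odd number is 1 modulo 8.
\<close>

lemma odd_exponent_mod_8:
  fixes y :: int
  assumes "n > 1" "odd n" and sq: "((45::int) ^ n - 1) * (100 ^ n - 1) = y\<^sup>2"
  shows "n mod 8 = 5"
proof (rule ccontr)
  assume "n mod 8 \<noteq> 5"
  with \<open>odd n\<close> have n: "n mod 8 \<in> {1, 3, 7}"
    by (simp, presburger)
  have "n = 3 + (n - 3)"
    using assms(1,2) by (cases "n = 2") auto
  then have "(100::int) ^ n = 32 * (31250 * 100 ^ (n - 3))"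
    using power_add[of "100::int" 3 "n - 3"] by simp
  then have "[(100::int) ^ n = 0] (mod 32)"
    by (simp add: cong_0_iff)
  moreover have "[(45::int) ^ n = 45 ^ (n mod 8)] (mod 32)"
    by (rule power_mod_exponent) simp
  ultimately have "[y\<^sup>2 = (45 ^ (n mod 8) - 1) * (0 - 1)] (mod 32)"
    unfolding sq[symmetric] by (intro cong_mult cong_diff cong_refl)
  then have "y\<^sup>2 mod 32 \<in> {20, 12, 28}"
    using n by (auto simp: cong_def)
  moreover have "(y mod 32)\<^sup>2 mod 32 = y\<^sup>2 mod 32"
    by (simp add: power_mod)
  moreover have "\<forall>z\<in>set [0..31]. z\<^sup>2 mod 32 \<notin> {20, 12, 28::int}"
    by (simp add: upto_rec1 del: set_upto)
  moreover have "y mod 32 \<in> set [0..31]"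
    unfolding set_upto using pos_mod_bound[of 32 y] pos_mod_sign[of 32 y] by simp
  ultimately show False
    by metis
qed

text \<open>
  The candidate divisors form a list, which the simplifier enumerates for numerals, and stop at the
  square root, which matters for 2161.
\<close>

lemma prime_by_trial_division:
  fixes p m :: nat
  assumes "p > 1" "p < m\<^sup>2" "\<forall>d\<in>set [2..<m]. \<not> d dvd p"
  shows "prime p"
  unfolding prime_divisor_sqrt
proof (intro conjI allI impI)
  fix d :: nat
  assume d: "d dvd p \<and> d\<^sup>2 \<le> p"
  then have "d\<^sup>2 < m\<^sup>2"
    using assms(2) by linarith
  then have "d < m"
    by (rule power2_less_imp_less) simp
  moreover have "d \<notin> set [2..<m]"
    using d assms(3) by blast
  ultimately have "d < 2"
    by (simp add: not_less)
  moreover have "d \<noteq> 0"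
    using d assms(1) by (intro notI) simp
  ultimately show "d = 1"
    by simp
qed (use assms(1) in simp)

text \<open>
  Modulo 7, 17, 31, 641 and 2161 the powers of 45 and 100 have the periods 6, 16, 15, 80 and 120.
  The primes 17 and 7 confine \<open>n\<close> to 21 and 37 modulo 48, that is, to ten classes modulo 240, and
  for each of these the product is a quadratic nonresidue modulo one of the other three primes.
\<close>

lemma exponent_5_mod_8:
  fixes y :: int
  assumes "n mod 8 = 5"
  shows "((45::int) ^ n - 1) * (100 ^ n - 1) \<noteq> y\<^sup>2"
proof
  assume sq: "((45::int) ^ n - 1) * (100 ^ n - 1) = y\<^sup>2"
  have excluded: "n mod M \<noteq> r"
    if "prime p" "p > 2" "mod_exp 45 M (int p) = 1" "mod_exp 100 M (int p) = 1"
      "mod_exp ((mod_exp 45 r (int p) - 1) * (mod_exp 100 r (int p) - 1) mod int p)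
         ((p - 1) div 2) (int p) = int p - 1" for p M r
    using not_square_mod_prime[OF that(1-4) _ that(5)] sq by blast
  have prime_641: "prime (641::nat)" and prime_2161: "prime (2161::nat)"
    by (rule prime_by_trial_division[of _ 47]; simp)+
  have mod6: "n mod 6 \<noteq> 5"
    by (rule excluded[of 7]) simp_all
  have mod16: "n mod 16 \<noteq> 13"
    by (rule excluded[of 17]) simp_all
  have mod15: "n mod 15 \<noteq> 3" "n mod 15 \<noteq> 6" "n mod 15 \<noteq> 9" "n mod 15 \<noteq> 12" "n mod 15 \<noteq> 13"
    by (rule excluded[of 31]; simp)+
  have mod80: "n mod 80 \<noteq> 5" "n mod 80 \<noteq> 37"
    by (rule excluded[OF prime_641]; simp)+
  have mod120: "n mod 120 \<noteq> 61" "n mod 120 \<noteq> 109"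
    by (rule excluded[OF prime_2161]; simp)+
  \<comment> \<open>It remains to check the fifteen classes modulo 240 that are 5 modulo 16.\<close>
  define k where "k = n div 16 mod 15"
  have "n mod 16 = 8 * (n div 8 mod 2) + n mod 8"
    using mod_mult2_eq[of n 8 2] by simp
  then have "n mod 16 = 5"
    using assms mod16 by (cases "even (n div 8)") (auto simp: odd_iff_mod_2_eq_one)
  then have nk: "n mod 240 = 16 * k + 5"
    using mod_mult2_eq[of n 16 15] by (simp add: k_def)
  have "k < 15"
    by (simp add: k_def)
  then have "k \<in> set [0..<15]"
    by simp
  moreover have "\<forall>k\<in>set [0..<15]. (16 * k + 5) mod 6 = 5 \<or> (16 * k + 5) mod 15 \<in> {3, 6, 9, 12, 13}
      \<or> (16 * k + 5) mod 80 \<in> {5, 37} \<or> (16 * k + 5) mod 120 \<in> {61, 109}"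
    by (simp add: upt_conv_Cons del: set_upt)
  ultimately have "(16 * k + 5) mod 6 = 5 \<or> (16 * k + 5) mod 15 \<in> {3, 6, 9, 12, 13}
      \<or> (16 * k + 5) mod 80 \<in> {5, 37} \<or> (16 * k + 5) mod 120 \<in> {61, 109}"
    by (rule bspec[rotated])
  moreover have "(16 * k + 5) mod 6 = n mod 6" "(16 * k + 5) mod 15 = n mod 15"
    "(16 * k + 5) mod 80 = n mod 80" "(16 * k + 5) mod 120 = n mod 120"
    unfolding nk[symmetric] by (simp_all add: mod_mod_cancel)
  ultimately show False
    by (simp only: mod6 mod15 mod80 mod120 insert_iff empty_iff simp_thms)
qed

theorem corollary15:
  fixes n x :: nat
  assumes "n > 0" and "x > 0"
  shows "((45::int) ^ n - 1) * (100 ^ n - 1) = (int x)\<^sup>2 \<longleftrightarrow> n = 1 \<and> x = 66"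
proof
  assume sq: "((45::int) ^ n - 1) * (100 ^ n - 1) = (int x)\<^sup>2"
  have "n = 1"
  proof (rule ccontr)
    assume "n \<noteq> 1"
    show False
    proof (cases "even n")
      case True
      then obtain m where m: "n = 2 * m"
        by auto
      with \<open>n > 0\<close> have "m > 0"
        by simp
      have "(((45::int) ^ m)\<^sup>2 - 1) * ((100 ^ m)\<^sup>2 - 1) = (int x)\<^sup>2"
        using sq by (simp add: m power_mult mult.commute flip: power_mult)
      moreover have "(5::int) dvd 45 ^ m" "(5::int) dvd 100 ^ m"
        using \<open>m > 0\<close> by (auto intro: dvd_trans[OF _ dvd_power])
      ultimately show False
        using no_pell_pair[of 5 "45 ^ m" "100 ^ m" "int x"] \<open>m > 0\<close> by simp
    next
      case False
      with \<open>n > 0\<close> \<open>n \<noteq> 1\<close> have "n mod 8 = 5"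
        using odd_exponent_mod_8[OF _ _ sq] by auto
      with exponent_5_mod_8 sq show False
        by blast
    qed
  qed
  with sq have "(int x)\<^sup>2 = 66\<^sup>2"
    by simp
  then have "x = 66"
    by (simp only: power2_eq_iff) simp
  with \<open>n = 1\<close> show "n = 1 \<and> x = 66"
    by simp
next
  assume "n = 1 \<and> x = 66"
  then show "((45::int) ^ n - 1) * (100 ^ n - 1) = (int x)\<^sup>2"
    by simp
qed

end
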